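(* There exists an adaptive randomized algorithm that, when the treewidth $k$ of the hidden graph is known, solves the Graph Reconstruction problem with a CC oracle using $\mathcal{O}(k^2\log n)$ CC queries, where $n$ is the number of vertices; its output is correct with high probability.
   Context: Graph Reconstruction (GR): an unknown ("hidden") simple undirected graph $G=(V,E)$ on a known vertex set $V$ with $|V|=n$ is to be determined, i.e. the algorithm must output $E$. A CC oracle, on query $S\subseteq V$, returns the partition of $S$ into the vertex sets of the connected components of the induced subgraph $G[S]$; complexity is the number of queries. An adaptive algorithm may choose queries depending on earlier answers. "Correct with high probability" means the output equals the hidden graph with probability tending to $1$ as $n\to\infty$. *)

theory Defs
  imports "HOL-Probability.Probability_Mass_Function"
begin

text \<open>A finite simple undirected graph is a vertex set together with a set of two-element edges.\<close>

definition simple_graph :: "'a set \<Rightarrow> 'a set set \<Rightarrow> bool" where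
  "simple_graph V E \<longleftrightarrow> finite V \<and> (\<forall>e\<in>E. e \<subseteq> V \<and> card e = 2)"

definition induced_adj :: "'a set set \<Rightarrow> 'a set \<Rightarrow> ('a \<times> 'a) set" where
  "induced_adj E S = {(u, v). u \<in> S \<and> v \<in> S \<and> {u, v} \<in> E}"

text \<open>The restriction to \<open>S \<times> S\<close> is needed because the reflexive-transitive closure relates
  every element of the type to itself.\<close>

definition induced_reach :: "'a set set \<Rightarrow> 'a set \<Rightarrow> ('a \<times> 'a) set" where
  "induced_reach E S = (induced_adj E S)\<^sup>* \<inter> S \<times> S"

definition cc_oracle :: "'a set set \<Rightarrow> 'a set \<Rightarrow> 'a set set" where
  "cc_oracle E S = S // induced_reach E S"

definition induced_connected :: "'a set set \<Rightarrow> 'a set \<Rightarrow> bool" where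
  "induced_connected E S \<longleftrightarrow> S \<noteq> {} \<and> (\<forall>u\<in>S. \<forall>v\<in>S. (u, v) \<in> induced_reach E S)"

text \<open>A cycle is listed without repeating its initial vertex.\<close>

definition is_cycle :: "'a set set \<Rightarrow> 'a list \<Rightarrow> bool" where
  "is_cycle E vs \<longleftrightarrow> length vs \<ge> 3 \<and> distinct vs \<and>
     (\<forall>i. Suc i < length vs \<longrightarrow> {vs ! i, vs ! Suc i} \<in> E) \<and> {last vs, hd vs} \<in> E"

definition is_tree :: "'a set \<Rightarrow> 'a set set \<Rightarrow> bool" where
  "is_tree V E \<longleftrightarrow> simple_graph V E \<and> induced_connected E V \<and> (\<nexists>vs. is_cycle E vs)"

text \<open>The third condition on the bags says that the tree nodes whose bag contains a given vertex
  induce a (nonempty) subtree.\<close>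

definition tree_decomposition ::
  "'a set \<Rightarrow> 'a set set \<Rightarrow> 'b set \<Rightarrow> 'b set set \<Rightarrow> ('b \<Rightarrow> 'a set) \<Rightarrow> bool" where
  "tree_decomposition V E I F B \<longleftrightarrow> is_tree I F \<and>
     (\<Union>i\<in>I. B i) = V \<and>
     (\<forall>e\<in>E. \<exists>i\<in>I. e \<subseteq> B i) \<and>
     (\<forall>v\<in>V. induced_connected F {i\<in>I. v \<in> B i})"

definition decomposition_width :: "'b set \<Rightarrow> ('b \<Rightarrow> 'a set) \<Rightarrow> nat" where
  "decomposition_width I B = Max ((\<lambda>i. card (B i)) ` I) - 1"

text \<open>Every finite tree has an isomorphic copy on natural numbers, so \<^typ>\<open>nat\<close> suffices as type
  of tree nodes. Subtraction truncates only for the graph without vertices, which thus has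
  treewidth \<open>0\<close> instead of the customary \<open>-1\<close>.\<close>

definition treewidth :: "'a set \<Rightarrow> 'a set set \<Rightarrow> nat" where
  "treewidth V E = (LEAST w. \<exists>(I :: nat set) F B.
     tree_decomposition V E I F B \<and> decomposition_width I B = w)"

text \<open>A deterministic adaptive algorithm is a decision tree: it either stops and outputs an edge
  set, or asks a query and continues depending on the answer (a partition of the queried set).
  A randomized algorithm is a probability distribution on such trees, that is, all coins are tossed
  in advance.\<close>

datatype 'a query_tree =
    Output "'a set set"
  | Query "'a set" "'a set set \<Rightarrow> 'a query_tree"

text \<open>The edge set argument of the following two functions is the hidden graph; it is accessed
  through the oracle only.\<close>

primrec run_queries :: "'a set set \<Rightarrow> 'a query_tree \<Rightarrow> 'a set list" where
  "run_queries E (Output R) = []"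
| "run_queries E (Query S f) = S # run_queries E (f (cc_oracle E S))"

primrec run_output :: "'a set set \<Rightarrow> 'a query_tree \<Rightarrow> 'a set set" where
  "run_output E (Output R) = R"
| "run_output E (Query S f) = run_output E (f (cc_oracle E S))"

end

theory Submission
  imports Defs "HOL-Probability.Product_PMF"
begin

text \<open>The chordal completion \<open>G\<close> of a width \<open>k\<close> tree decomposition of the hidden graph arises by
  attaching vertices one by one to cliques of size at most \<open>k\<close>. Two vertices not adjacent in \<open>G\<close>
  are separated by at most \<open>k\<close> vertices, so a random query that contains every vertex with
  probability \<open>1 / (k + 1)\<close> certifies with probability at least \<open>1 / (3 * (k + 1)\<^sup>2)\<close> that they are
  not adjacent. After \<open>O(k\<^sup>2 log n)\<close> such queries the set \<open>H\<close> of the pairs that were never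
  separated is, with high probability, contained in \<open>G\<close>, and it always contains all edges. Now \<open>G\<close>
  has a proper coloring with \<open>k + 1\<close> colors, and any two color classes induce a forest in \<open>G\<close>, as
  a chordal graph without triangles is a forest. In a subgraph of a forest, the end points of an
  edge of the forest are connected only if the edge itself is present. Hence querying the
  \<open>O(k\<^sup>2)\<close> unions of two color classes determines which pairs in \<open>H\<close> are edges.\<close>

section \<open>Chordal completions\<close>

text \<open>The edge set of the complete graph on \<open>A\<close>;
  \<open>pairs K \<subseteq> G\<close> thus makes \<open>K\<close> a clique of
  \<open>G\<close>.\<close>

definition pairs :: "'a set \<Rightarrow> 'a set set" where
  "pairs A = {{a, b} | a b. a \<in> A \<and> b \<in> A \<and> a \<noteq> b}"

lemma pairs_iff: "{a, b} \<in> pairs A \<longleftrightarrow> a \<in> A \<and> b \<in> A \<and> a \<noteq> b"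
  by (auto simp: pairs_def doubleton_eq_iff)

lemma pairs_mono: "A \<subseteq> B \<Longrightarrow> pairs A \<subseteq> pairs B"
  by (auto simp: pairs_def)

lemma pairs_insert: "pairs (insert v A) = pairs A \<union> {{v, x} | x. x \<in> A - {v}}"
  by (auto simp: pairs_def insert_commute)

text \<open>A perfect elimination order read backwards: this yields the finite chordal graphs whose
  cliques have at most \<open>k + 1\<close> vertices.\<close>

inductive chordal :: "nat \<Rightarrow> 'a set \<Rightarrow> 'a set set \<Rightarrow> bool" for k where
  empty: "chordal k {} {}"
| insert: "chordal k W G \<Longrightarrow> v \<notin> W \<Longrightarrow> K \<subseteq> W \<Longrightarrow> finite K \<Longrightarrow> card K \<le> k \<Longrightarrow> pairs K \<subseteq> G
    \<Longrightarrow> chordal k (insert v W) (G \<union> {{v, x} | x. x \<in> K})"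

lemma chordal_edges: "chordal k W G \<Longrightarrow> {a, b} \<in> G \<Longrightarrow> a \<in> W \<and> b \<in> W \<and> a \<noteq> b"
proof (induction arbitrary: a b rule: chordal.induct)
  case (insert W G v K)
  then consider "{a, b} \<in> G" | x where "x \<in> K" "{a, b} = {v, x}"
    by blast
  then show ?case
    using insert.IH[of a b] insert.hyps by cases (auto simp: doubleton_eq_iff)
qed simp

text \<open>Each attached \<open>K\<close> is finite of cardinality 0, hence empty. This settles
  hidden graphs of treewidth 0, which must be found without any query.\<close>

lemma chordal_0: "chordal 0 W G \<Longrightarrow> G = {}"
  by (induction rule: chordal.induct) auto

text \<open>The vertices of \<open>A - W\<close> are attached one by one, each to the part of
  \<open>A\<close> already present. Later \<open>A\<close> is a new bag of a tree
  decomposition.\<close>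

lemma chordal_add_clique:
  assumes "chordal k W G" "finite A" "card A \<le> k + 1" "pairs (A \<inter> W) \<subseteq> G"
  shows "chordal k (W \<union> A) (G \<union> pairs A)"
proof -
  have "chordal k (W \<union> D) (G \<union> pairs ((A \<inter> W) \<union> D))" if "finite D" "D \<subseteq> A - W" for D
    using that
  proof (induction D rule: finite_induct)
    case empty
    then show ?case
      using assms by (simp add: sup.absorb1)
  next
    case (insert d D)
    let ?K = "(A \<inter> W) \<union> D"
    \<comment> \<open>The vertex \<open>d\<close> of \<open>A\<close> is missing from
      \<open>?K\<close>, which turns the bound \<open>k + 1\<close> into \<open>k\<close>.\<close>
    have "card ?K < card A"
      using insert assms(2) by (intro psubset_card_mono) auto
    then have "chordal k (insert d (W \<union> D)) ((G \<union> pairs ?K) \<union> {{d, x} | x. x \<in> ?K})"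
      using insert assms by (intro chordal.insert) auto
    moreover have "?K - {d} = ?K"
      using insert by auto
    ultimately show ?case
      using insert by (simp add: pairs_insert Un_assoc)
  qed
  moreover have "W \<union> (A - W) = W \<union> A" "(A \<inter> W) \<union> (A - W) = A"
    by auto
  ultimately show ?thesis
    using assms(2) by (metis finite_Diff subset_refl)
qed

text \<open>The separation is witnessed by the side \<open>T\<close> of \<open>u\<close>. A new vertex joins \<open>T\<close> iff it has a
  neighbor there; its neighbors, being a clique, then all lie in \<open>T \<union> X\<close>.\<close>

lemma chordal_separator:
  assumes "chordal k W G" "u \<in> W" "w \<in> W" "u \<noteq> w" "{u, w} \<notin> G"
  shows "\<exists>T X. X \<subseteq> W \<and> card X \<le> k \<and> u \<in> T \<and> u \<notin> X \<and> w \<notin> T \<and> w \<notin> X \<and>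
    (\<forall>a b. {a, b} \<in> G \<longrightarrow> a \<in> T \<longrightarrow> b \<in> T \<union> X)"
  using assms
proof (induction arbitrary: u w rule: chordal.induct)
  case empty
  then show ?case by simp
next
  case (insert W G v K)
  note edges = chordal_edges[OF insert.hyps(1)]
  let ?G = "G \<union> {{v, x} | x. x \<in> K}"
  have edge_cases: "{a, b} \<in> G \<and> a \<noteq> v \<and> b \<noteq> v \<or> a = v \<and> b \<in> K \<or> b = v \<and> a \<in> K"
    if "{a, b} \<in> ?G" for a b
  proof -
    have "{a, b} \<in> G \<or> (\<exists>x\<in>K. {a, b} = {v, x})"
      using that by blast
    then show ?thesis
      using edges[of a b] insert.hyps(2) by (auto simp: doubleton_eq_iff)
  qed
  have new: "{v, x} \<in> ?G" "{x, v} \<in> ?G" if "x \<in> K" for x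
    using that by (auto simp: insert_commute)
  consider "u = v" | "w = v" | "u \<in> W" "w \<in> W"
    using insert.prems by auto
  then show ?case
  proof cases
    case 1
    \<comment> \<open>The neighborhood \<open>K\<close> of the new vertex cuts it off.\<close>
    have closed: "b \<in> {v} \<union> K" if "{a, b} \<in> ?G" "a \<in> {v}" for a b
      using edge_cases[OF that(1)] that(2) by blast
    have "w \<notin> K"
      using 1 insert.prems(4) new by blast
    then show ?thesis
      by - (rule exI[of _ "{v}"], rule exI[of _ K], use 1 insert.hyps insert.prems closed in blast)
  next
    case 2
    \<comment> \<open>The same cut seen from the side of \<open>u\<close>: all old vertices outside
      \<open>K\<close>.\<close>
    have closed: "b \<in> (W - K) \<union> K" if "{a, b} \<in> ?G" "a \<in> W - K" for a b
      using edge_cases[OF that(1)] that(2) edges[of a b] insert.hyps(2) by blast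
    have "u \<in> W" "u \<notin> K"
      using 2 insert.prems new by blast+
    then show ?thesis
      by - (rule exI[of _ "W - K"], rule exI[of _ K], use 2 insert.hyps closed in blast)
  next
    case 3
    then obtain T X where TX: "X \<subseteq> W" "card X \<le> k" "u \<in> T" "u \<notin> X" "w \<notin> T" "w \<notin> X"
      and closed: "\<And>a b. {a, b} \<in> G \<Longrightarrow> a \<in> T \<Longrightarrow> b \<in> T \<union> X"
      using insert.IH[of u w] insert.prems by auto
    have "u \<noteq> v" "w \<noteq> v"
      using 3 insert.hyps by auto
    show ?thesis
    proof (cases "K \<inter> T = {}")
      case True
      \<comment> \<open>\<open>T\<close> is not known to lie inside \<open>W\<close>, so
        \<open>v\<close> is removed explicitly.\<close>
      have "b \<in> (T - {v}) \<union> X" if "{a, b} \<in> ?G" "a \<in> T - {v}" for a b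
        using edge_cases[OF that(1)] that(2) closed[of a b] True by blast
      then show ?thesis
        by - (rule exI[of _ "T - {v}"], rule exI[of _ X], use TX \<open>u \<noteq> v\<close> in blast)
    next
      case False
      then obtain y where y: "y \<in> K" "y \<in> T" by auto
      have "K \<subseteq> T \<union> X"
      proof
        fix x assume "x \<in> K"
        then have "x = y \<or> {y, x} \<in> G"
          using y insert.hyps(6) pairs_iff[of y x K] by blast
        then show "x \<in> T \<union> X"
          using y closed by blast
      qed
      then have "b \<in> insert v T \<union> X" if "{a, b} \<in> ?G" "a \<in> insert v T" for a b
        using edge_cases[OF that(1)] that(2) closed[of a b] by blast
      then show ?thesis
        by - (rule exI[of _ "insert v T"], rule exI[of _ X], use TX \<open>w \<noteq> v\<close> in blast)
    qed
  qed
qed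

text \<open>The last conjunct says that \<open>{u, w}\<close> is a bridge of the subgraph that is induced by the color
  classes of \<open>u\<close> and \<open>w\<close>.\<close>

lemma chordal_coloring:
  assumes "chordal k W G"
  shows "\<exists>c :: 'a \<Rightarrow> nat. (\<forall>x. c x \<le> k) \<and> (\<forall>a b. {a, b} \<in> G \<longrightarrow> c a \<noteq> c b) \<and>
    (\<forall>u w. {u, w} \<in> G \<longrightarrow> (\<exists>T. u \<in> T \<and> w \<notin> T \<and>
      (\<forall>a b. {a, b} \<in> G \<longrightarrow> a \<in> T \<longrightarrow> b \<notin> T \<longrightarrow> c a \<in> {c u, c w} \<longrightarrow> c b \<in> {c u, c w} \<longrightarrow>
        {a, b} = {u, w})))"
  using assms
proof (induction rule: chordal.induct)
  case empty
  then show ?case by (intro exI[of _ "\<lambda>_. 0"]) auto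
next
  case (insert W G v K)
  note edges = chordal_edges[OF insert.hyps(1)]
  let ?G = "G \<union> {{v, x} | x. x \<in> K}"
  obtain c :: "'a \<Rightarrow> nat" where le: "\<And>x. c x \<le> k"
    and proper: "\<And>a b. {a, b} \<in> G \<Longrightarrow> c a \<noteq> c b"
    and cut: "\<And>u w. {u, w} \<in> G \<Longrightarrow> \<exists>T. u \<in> T \<and> w \<notin> T \<and>
      (\<forall>a b. {a, b} \<in> G \<longrightarrow> a \<in> T \<longrightarrow> b \<notin> T \<longrightarrow> c a \<in> {c u, c w} \<longrightarrow> c b \<in> {c u, c w} \<longrightarrow>
        {a, b} = {u, w})"
    using insert.IH by blast
  \<comment> \<open>Greedy coloring: at most \<open>k\<close> of the \<open>k + 1\<close> colors
    occur on \<open>K\<close>, so one is free for \<open>v\<close>.\<close>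
  have "card (c ` K) < card {..k}"
    using card_image_le[of K c] insert.hyps by simp
  then obtain m where m: "m \<le> k" "m \<notin> c ` K"
    using insert.hyps by (metis atMost_iff card_mono finite_imageI leD subsetI)
  define d where "d = c(v := m)"
  have d_old: "d x = c x" if "x \<in> W" for x
    using that insert.hyps by (auto simp: d_def)
  have d_v: "d v = m" by (simp add: d_def)
  have d_le: "d x \<le> k" for x
    using le m by (simp add: d_def)
  have d_K: "d x \<noteq> d v" if "x \<in> K" for x
    using that d_old[of x] d_v m insert.hyps by auto
  have edge_cases: "{a, b} \<in> G \<or> a = v \<and> b \<in> K \<or> b = v \<and> a \<in> K" if "{a, b} \<in> ?G" for a b
  proof -
    have "{a, b} \<in> G \<or> (\<exists>x\<in>K. {a, b} = {v, x})"
      using that by blast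
    then show ?thesis
      by (auto simp: doubleton_eq_iff)
  qed
  have d_proper: "d a \<noteq> d b" if "{a, b} \<in> ?G" for a b
    using edge_cases[OF that] edges[of a b] d_old[of a] d_old[of b] d_K proper[of a b] by metis
  \<comment> \<open>The clique \<open>K\<close> is properly colored, so \<open>v\<close> has at most
    one neighbor of each color.\<close>
  have K_inj: "x = y" if "x \<in> K" "y \<in> K" "d x = d y" for x y
  proof (rule ccontr)
    assume "x \<noteq> y"
    then have "{x, y} \<in> G"
      using that insert.hyps(6) pairs_iff[of x y K] by blast
    then show False
      using d_proper that by blast
  qed
  have "\<exists>T. u \<in> T \<and> w \<notin> T \<and> (\<forall>a b. {a, b} \<in> ?G \<longrightarrow> a \<in> T \<longrightarrow> b \<notin> T \<longrightarrow>
      d a \<in> {d u, d w} \<longrightarrow> d b \<in> {d u, d w} \<longrightarrow> {a, b} = {u, w})"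
    if uw: "{u, w} \<in> ?G" for u w
  proof -
    have v_notin: "{v, b} \<notin> G" "{b, v} \<notin> G" for b
      using edges insert.hyps by blast+
    consider "u = v" "w \<in> K" | "w = v" "u \<in> K" | "{u, w} \<in> G"
      using edge_cases[OF uw] by blast
    then show ?thesis
    proof cases
      case 1
      \<comment> \<open>Only \<open>w\<close> among the neighbors of \<open>v\<close> has color
        \<open>d w\<close>, so within the two classes no other edge leaves
        \<open>{v}\<close>.\<close>
      have "{a, b} = {u, w}" if "{a, b} \<in> ?G" "a \<in> {v}" "b \<notin> {v}" "d b \<in> {d u, d w}" for a b
        using edge_cases[OF that(1)] that(2-4) 1 K_inj[of b w] d_K[of b] v_notin by auto
      then show ?thesis
        using 1 insert.hyps by (intro exI[of _ "{v}"]) blast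
    next
      case 2
      have "{a, b} = {u, w}" if "{a, b} \<in> ?G" "a \<in> - {v}" "b \<notin> - {v}" "d a \<in> {d u, d w}" for a b
        using edge_cases[OF that(1)] that(2-4) 2 K_inj[of a u] d_K[of a] v_notin by auto
      then show ?thesis
        using 2 insert.hyps by (intro exI[of _ "- {v}"]) blast
    next
      case 3
      then obtain T where T: "u \<in> T" "w \<notin> T"
        and cross: "\<And>a b. {a, b} \<in> G \<Longrightarrow> a \<in> T \<Longrightarrow> b \<notin> T \<Longrightarrow> c a \<in> {c u, c w} \<Longrightarrow>
          c b \<in> {c u, c w} \<Longrightarrow> {a, b} = {u, w}"
        using cut[of u w] by blast
      have uw': "u \<in> W" "w \<in> W" "u \<noteq> v" "w \<noteq> v"
        using edges[OF 3] insert.hyps by auto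
      \<comment> \<open>If \<open>v\<close> has one of the two colors, it joins the side of its
        neighbor with the other color, if there is one; then no edge at \<open>v\<close> crosses.
        Otherwise its side does not matter.\<close>
      define T' where
        "T' = (if \<exists>y\<in>K \<inter> T. d y \<in> {d u, d w} then insert v T else T - {v})"
      have T'_iff: "x \<in> T' \<longleftrightarrow> x \<in> T" if "x \<noteq> v" for x
        using that by (auto simp: T'_def)
      text \<open>At most one neighbor of \<open>v\<close> has one of the two colors.\<close>
      have v_T': "v \<in> T' \<longleftrightarrow> y \<in> T"
        if "y \<in> K" "d y \<in> {d u, d w}" "d v \<in> {d u, d w}" for y
      proof -
        have "x = y" if "x \<in> K" "d x \<in> {d u, d w}" for x
          using that \<open>y \<in> K\<close> \<open>d y \<in> {d u, d w}\<close> \<open>d v \<in> {d u, d w}\<close> K_inj[of x y] d_K[of x] d_K[of y]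
          by auto
        then have "(\<exists>x\<in>K \<inter> T. d x \<in> {d u, d w}) \<longleftrightarrow> y \<in> T"
          using that(1,2) by blast
        then show ?thesis
          unfolding T'_def by (simp split: if_split)
      qed
      have K_v: "x \<noteq> v" if "x \<in> K" for x
        using that insert.hyps by blast
      have "{a, b} = {u, w}"
        if ab: "{a, b} \<in> ?G" "a \<in> T'" "b \<notin> T'" "d a \<in> {d u, d w}" "d b \<in> {d u, d w}" for a b
        using edge_cases[OF ab(1)]
      proof (elim disjE conjE)
        assume "{a, b} \<in> G"
        moreover from edges[OF this] have "a \<in> W" "b \<in> W" "a \<noteq> v" "b \<noteq> v"
          using insert.hyps by auto
        ultimately show ?thesis
          using cross[of a b] ab(2-5) d_old[of a] d_old[of b] d_old[OF uw'(1)] d_old[OF uw'(2)]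
            T'_iff[of a] T'_iff[of b] by simp
      next
        assume "a = v" "b \<in> K"
        then show ?thesis
          using v_T'[of b] ab(2-5) T'_iff[of b] K_v[of b] by metis
      next
        assume "b = v" "a \<in> K"
        then show ?thesis
          using v_T'[of a] ab(2-5) T'_iff[of a] K_v[of a] by metis
      qed
      moreover have "u \<in> T'" "w \<notin> T'"
        using T T'_iff uw' by auto
      ultimately show ?thesis
        by (intro exI[of _ T'] conjI allI impI)
    qed
  qed
  then show ?case
    using d_le d_proper by blast
qed

section \<open>From tree decompositions to chordal completions\<close>

lemma sym_induced_adj: "sym (induced_adj E S)"
  by (auto simp: induced_adj_def sym_def insert_commute)

lemma induced_adj_mono: "E \<subseteq> E' \<Longrightarrow> S \<subseteq> S' \<Longrightarrow> induced_adj E S \<subseteq> induced_adj E' S'"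
  by (auto simp: induced_adj_def)

text \<open>A path that comes back to \<open>c\<close> is truncated there. Distinctness is what
  \<open>is_cycle\<close> demands.\<close>

lemma rtrancl_distinct_path:
  assumes "(a, b) \<in> R\<^sup>*"
  shows "\<exists>xs. xs \<noteq> [] \<and> hd xs = a \<and> last xs = b \<and> distinct xs \<and>
    (\<forall>i. Suc i < length xs \<longrightarrow> (xs ! i, xs ! Suc i) \<in> R)"
  using assms
proof (induction rule: rtrancl_induct)
  case base
  show ?case by (intro exI[of _ "[a]"]) auto
next
  case (step b c)
  then obtain xs where xs: "xs \<noteq> []" "hd xs = a" "last xs = b" "distinct xs"
    and path: "\<And>i. Suc i < length xs \<Longrightarrow> (xs ! i, xs ! Suc i) \<in> R"
    by blast
  show ?case
  proof (cases "c \<in> set xs")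
    case True
    then obtain n where n: "n < length xs" "xs ! n = c"
      by (auto simp: in_set_conv_nth)
    have "last (take (Suc n) xs) = c"
      using n by (simp add: take_Suc_conv_app_nth)
    then show ?thesis
      using xs n path by (intro exI[of _ "take (Suc n) xs"]) auto
  next
    case False
    have "((xs @ [c]) ! i, (xs @ [c]) ! Suc i) \<in> R" if "Suc i < length (xs @ [c])" for i
    proof (cases "Suc i < length xs")
      case True
      then show ?thesis using path by (simp add: nth_append)
    next
      case False
      then have "i = length xs - 1" "Suc i = length xs"
        using that by auto
      then show ?thesis
        using step(2) xs by (simp add: nth_append last_conv_nth)
    qed
    then show ?thesis
      using xs False by (intro exI[of _ "xs @ [c]"]) auto
  qed
qed

text \<open>A distinct path from \<open>i\<close> to \<open>p\<close> avoiding the edge would close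
  up with it to a cycle. Length 1 contradicts \<open>p \<noteq> i\<close>, and length 2 would use
  the removed edge.\<close>

lemma acyclic_edge_is_bridge:
  assumes "\<nexists>vs. is_cycle F vs" "{p, i} \<in> F" "p \<noteq> i"
  shows "(i, p) \<notin> (induced_adj (F - {{p, i}}) UNIV)\<^sup>*"
proof
  assume "(i, p) \<in> (induced_adj (F - {{p, i}}) UNIV)\<^sup>*"
  then obtain xs where xs: "xs \<noteq> []" "hd xs = i" "last xs = p" "distinct xs"
    and "\<And>j. Suc j < length xs \<Longrightarrow> (xs ! j, xs ! Suc j) \<in> induced_adj (F - {{p, i}}) UNIV"
    using rtrancl_distinct_path[of i p] by metis
  then have path: "{xs ! j, xs ! Suc j} \<in> F - {{p, i}}" if "Suc j < length xs" for j
    using that by (simp add: induced_adj_def)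
  have "length xs \<noteq> 1"
    using xs assms(3) by (auto simp: length_Suc_conv)
  moreover have "length xs \<noteq> 2"
  proof
    assume "length xs = 2"
    then obtain a b where "xs = [a, b]"
      by (auto simp: length_Suc_conv numeral_2_eq_2)
    then show False
      using path[of 0] xs by (auto simp: insert_commute)
  qed
  moreover have "length xs \<noteq> 0"
    using xs by simp
  ultimately have "3 \<le> length xs" by linarith
  then have "is_cycle F xs"
    using xs path assms(2) by (auto simp: is_cycle_def)
  with assms(1) show False by blast
qed

text \<open>If \<open>x\<close> were missing from the bag of \<open>p\<close>, then \<open>i\<close> and \<open>p\<close> would be connected through \<open>j\<close>
  without the edge between them.\<close>

lemma running_intersection:
  assumes "\<nexists>vs. is_cycle F vs" "{p, i} \<in> F" "p \<noteq> i"
    and J: "induced_connected F J" "p \<in> J" "i \<notin> J" "j \<in> J"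
    and x: "induced_connected F {l \<in> I. x \<in> B l}" "i \<in> I" "j \<in> I" "x \<in> B i" "x \<in> B j"
  shows "x \<in> B p"
proof (rule ccontr)
  assume "x \<notin> B p"
  let ?R = "induced_adj (F - {{p, i}}) UNIV"
  have "induced_adj F {l \<in> I. x \<in> B l} \<subseteq> ?R"
    using \<open>x \<notin> B p\<close> by (auto simp: induced_adj_def doubleton_eq_iff)
  moreover have "(i, j) \<in> (induced_adj F {l \<in> I. x \<in> B l})\<^sup>*"
    using x unfolding induced_connected_def induced_reach_def by auto
  ultimately have "(i, j) \<in> ?R\<^sup>*"
    by (meson rtrancl_mono subsetD)
  moreover have "induced_adj F J \<subseteq> ?R"
    using J by (auto simp: induced_adj_def doubleton_eq_iff)
  moreover have "(j, p) \<in> (induced_adj F J)\<^sup>*"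
    using J unfolding induced_connected_def induced_reach_def by auto
  ultimately have "(i, p) \<in> ?R\<^sup>*"
    by (meson rtrancl_mono rtrancl_trans subsetD)
  with acyclic_edge_is_bridge[OF assms(1-3)] show False by blast
qed

text \<open>A walk from inside \<open>J\<close> to outside must leave \<open>J\<close> somewhere.
  This lets a subtree grow node by node.\<close>

lemma induced_connected_crossing_edge:
  assumes "induced_connected F I" "J \<subseteq> I" "J \<noteq> {}" "J \<noteq> I"
  obtains p i where "p \<in> J" "i \<in> I - J" "{p, i} \<in> F"
proof -
  obtain a b where ab: "a \<in> J" "b \<in> I - J"
    using assms by blast
  have "(a, b) \<in> (induced_adj F I)\<^sup>*"
    using assms ab unfolding induced_connected_def induced_reach_def by auto
  moreover have "\<exists>p\<in>J. \<exists>i\<in>I - J. {p, i} \<in> F"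
    if "(a, b) \<in> (induced_adj F I)\<^sup>*" "b \<notin> J" for b
    using that
    by (induction rule: rtrancl_induct) (use ab in \<open>auto simp: induced_adj_def\<close>)
  ultimately show thesis
    using ab that by blast
qed

lemma induced_connected_insert:
  assumes "induced_connected F J" "p \<in> J" "{p, i} \<in> F"
  shows "induced_connected F (insert i J)"
proof -
  let ?R = "induced_adj F (insert i J)"
  have to_p: "(a, p) \<in> ?R\<^sup>*" if "a \<in> insert i J" for a
  proof (cases "a \<in> J")
    case True
    then have "(a, p) \<in> (induced_adj F J)\<^sup>*"
      using assms unfolding induced_connected_def induced_reach_def by auto
    then show ?thesis
      by (meson induced_adj_mono rtrancl_mono subsetD subset_insertI subset_refl)
  next
    case False
    then show ?thesis
      using that assms by (auto simp: induced_adj_def insert_commute)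
  qed
  then have "(p, a) \<in> ?R\<^sup>*" if "a \<in> insert i J" for a
    using that sym_induced_adj sym_rtrancl symD by metis
  with to_p show ?thesis
    unfolding induced_connected_def induced_reach_def
    by (auto intro: rtrancl_trans)
qed

text \<open>Bags are turned into cliques along a growing subtree \<open>J\<close>. A new bag meets
  the earlier ones inside the bag of its neighbor \<open>p\<close> in \<open>J\<close>, hence in a
  clique, so \<open>chordal_add_clique\<close> applies.\<close>

lemma tree_decomposition_chordal:
  assumes td: "tree_decomposition V E I F B" and "simple_graph V E"
    and width: "\<And>i. i \<in> I \<Longrightarrow> card (B i) \<le> k + 1"
  shows "\<exists>G. chordal k V G \<and> E \<subseteq> G"
proof -
  have conn: "induced_connected F I" and acyc: "\<nexists>vs. is_cycle F vs"
    and "finite I" and F: "\<And>e. e \<in> F \<Longrightarrow> card e = 2"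
    and V: "(\<Union>i\<in>I. B i) = V"
    and E: "\<And>e. e \<in> E \<Longrightarrow> \<exists>i\<in>I. e \<subseteq> B i"
    and sub: "\<And>v. v \<in> V \<Longrightarrow> induced_connected F {i \<in> I. v \<in> B i}"
    using td by (auto simp: tree_decomposition_def is_tree_def simple_graph_def)
  have finB: "finite (B i)" if "i \<in> I" for i
    using that V assms(2) by (auto simp: simple_graph_def intro: finite_subset)
  have "\<exists>J\<subseteq>I. card J = Suc m \<and> induced_connected F J \<and>
      chordal k (\<Union>j\<in>J. B j) (\<Union>j\<in>J. pairs (B j))" if "Suc m \<le> card I" for m
    using that
  proof (induction m)
    case 0
    obtain r where "r \<in> I"
      using conn by (auto simp: induced_connected_def)
    moreover have "chordal k ({} \<union> B r) ({} \<union> pairs (B r))"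
      using \<open>r \<in> I\<close> finB width
      by (intro chordal_add_clique chordal.empty) (auto simp: pairs_def)
    ultimately show ?case
      by (intro exI[of _ "{r}"]) (auto simp: induced_connected_def induced_reach_def)
  next
    case (Suc m)
    then obtain J where J: "J \<subseteq> I" "card J = Suc m" "induced_connected F J"
      and ch: "chordal k (\<Union>j\<in>J. B j) (\<Union>j\<in>J. pairs (B j))"
      by auto
    have "J \<noteq> {}" "J \<noteq> I"
      using J Suc.prems by auto
    then obtain p i where pi: "p \<in> J" "i \<in> I - J" "{p, i} \<in> F"
      using induced_connected_crossing_edge[OF conn J(1)] by metis
    have "p \<noteq> i" using pi by auto
    have "B i \<inter> (\<Union>j\<in>J. B j) \<subseteq> B p"
    proof
      fix x assume "x \<in> B i \<inter> (\<Union>j\<in>J. B j)"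
      then obtain j where j: "x \<in> B i" "j \<in> J" "x \<in> B j" by auto
      then have "x \<in> V" using V J by auto
      show "x \<in> B p"
        by (rule running_intersection[OF acyc pi(3) \<open>p \<noteq> i\<close> J(3) pi(1) _ j(2) sub[OF \<open>x \<in> V\<close>]])
          (use pi j J in auto)
    qed
    then have "pairs (B i \<inter> (\<Union>j\<in>J. B j)) \<subseteq> pairs (B p)"
      by (rule pairs_mono)
    then have "pairs (B i \<inter> (\<Union>j\<in>J. B j)) \<subseteq> (\<Union>j\<in>J. pairs (B j))"
      using pi by blast
    then have "chordal k ((\<Union>j\<in>J. B j) \<union> B i) ((\<Union>j\<in>J. pairs (B j)) \<union> pairs (B i))"
      using ch pi finB width by (intro chordal_add_clique) auto
    moreover have "card (insert i J) = Suc (Suc m)"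
      using J pi \<open>finite I\<close> by (metis DiffD2 card_insert_disjoint finite_subset)
    ultimately show ?case
      using J pi induced_connected_insert[OF J(3) pi(1,3)]
      by (intro exI[of _ "insert i J"]) (simp add: Un_commute)
  qed
  from this[of "card I - 1"] obtain J where J: "J \<subseteq> I" "card J = card I"
    and ch: "chordal k (\<Union>j\<in>J. B j) (\<Union>j\<in>J. pairs (B j))"
    using conn \<open>finite I\<close> by (auto simp: induced_connected_def card_gt_0_iff Suc_le_eq)
  have "J = I"
    using J \<open>finite I\<close> by (simp add: card_subset_eq)
  have "E \<subseteq> (\<Union>j\<in>I. pairs (B j))"
  proof
    fix e assume "e \<in> E"
    then have "card e = 2"
      using assms(2) by (simp add: simple_graph_def)
    then obtain a b where "e = {a, b}" "a \<noteq> b"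
      by (auto simp: card_2_iff)
    then show "e \<in> (\<Union>j\<in>I. pairs (B j))"
      using E[OF \<open>e \<in> E\<close>] by (auto simp: pairs_iff)
  qed
  then show ?thesis
    using ch \<open>J = I\<close> V by blast
qed

section \<open>Treewidth\<close>

text \<open>Shows that the least width in the definition of \<open>treewidth\<close> is attained,
  and bounds it.\<close>

lemma trivial_tree_decomposition:
  assumes "simple_graph V E"
  shows "tree_decomposition V E {0 :: nat} {} (\<lambda>_. V)"
proof -
  have "induced_connected {} {0 :: nat}"
    by (simp add: induced_connected_def induced_reach_def)
  moreover have "\<not> is_cycle {} vs" for vs :: "nat list"
    by (simp add: is_cycle_def)
  ultimately show ?thesis
    using assms unfolding tree_decomposition_def is_tree_def simple_graph_def by auto
qed

text \<open>Forces at least two vertices when the treewidth is positive, so that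
  \<open>ln (card V)\<close> stays away from 0.\<close>

lemma treewidth_le:
  assumes "simple_graph V E"
  shows "treewidth V E \<le> card V - 1"
proof -
  have "decomposition_width {0 :: nat} (\<lambda>_. V) = card V - 1"
    by (simp add: decomposition_width_def)
  then show ?thesis
    unfolding treewidth_def by (intro Least_le) (use trivial_tree_decomposition[OF assms] in blast)
qed

lemma treewidth_chordal:
  assumes "simple_graph V E"
  shows "\<exists>G. chordal (treewidth V E) V G \<and> E \<subseteq> G"
proof -
  have "\<exists>(I :: nat set) F B. tree_decomposition V E I F B \<and>
      decomposition_width I B = treewidth V E"
    unfolding treewidth_def
    by (rule LeastI_ex) (use trivial_tree_decomposition[OF assms] in blast)
  then obtain I :: "nat set" and F B where td: "tree_decomposition V E I F B"
    and w: "decomposition_width I B = treewidth V E"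
    by blast
  have "finite I"
    using td by (simp add: tree_decomposition_def is_tree_def simple_graph_def)
  have "card (B i) \<le> treewidth V E + 1" if "i \<in> I" for i
  proof -
    have "card (B i) \<le> Max ((\<lambda>i. card (B i)) ` I)"
      using that \<open>finite I\<close> by (intro Max_ge) auto
    \<comment> \<open>Truncation in \<open>decomposition_width\<close> is harmless:
      \<open>M \<le> (M - 1) + 1\<close> holds for \<open>M = 0\<close> too.\<close>
    then show ?thesis
      using w unfolding decomposition_width_def by linarith
  qed
  with td assms show ?thesis
    by (intro tree_decomposition_chordal) auto
qed

section \<open>The algorithm\<close>

definition same_block :: "'a set set \<Rightarrow> 'a \<Rightarrow> 'a \<Rightarrow> bool" where
  "same_block P u w \<longleftrightarrow> (\<exists>C\<in>P. u \<in> C \<and> w \<in> C)"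

lemma same_block_cc_oracle:
  assumes "u \<in> S" "w \<in> S"
  shows "same_block (cc_oracle E S) u w \<longleftrightarrow> (u, w) \<in> (induced_adj E S)\<^sup>*"
proof -
  have "sym ((induced_adj E S)\<^sup>*)"
    by (intro sym_rtrancl sym_induced_adj)
  with assms show ?thesis
    unfolding same_block_def cc_oracle_def quotient_def induced_reach_def
    by (auto dest: symD intro: rtrancl_trans)
qed

text \<open>A nonadaptive batch in continuation-passing form, so that a later batch can depend on
  the recorded answers.\<close>

primrec ask_all :: "'a set list \<Rightarrow> (('a set \<times> 'a set set) list \<Rightarrow> 'a query_tree) \<Rightarrow> 'a query_tree"
  where
    "ask_all [] f = f []"
  | "ask_all (S # Ss) f = Query S (\<lambda>P. ask_all Ss (\<lambda>R. f ((S, P) # R)))"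

lemma run_queries_ask_all:
  "run_queries E (ask_all Ss f) = Ss @ run_queries E (f (map (\<lambda>S. (S, cc_oracle E S)) Ss))"
  by (induction Ss arbitrary: f) auto

lemma run_output_ask_all:
  "run_output E (ask_all Ss f) = run_output E (f (map (\<lambda>S. (S, cc_oracle E S)) Ss))"
  by (induction Ss arbitrary: f) auto

text \<open>Determined by queries and answers alone: the pairs not yet ruled out as edges.\<close>

definition unseparated :: "'a set \<Rightarrow> ('a set \<times> 'a set set) list \<Rightarrow> 'a set set" where
  "unseparated V R = {{u, w} | u w. u \<in> V \<and> w \<in> V \<and> u \<noteq> w \<and>
     (\<forall>(S, P)\<in>set R. u \<in> S \<longrightarrow> w \<in> S \<longrightarrow> same_block P u w)}"

lemma same_block_commute: "same_block P u w \<longleftrightarrow> same_block P w u"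
  by (auto simp: same_block_def)

lemma unseparated_cc_oracle_iff:
  "{u, w} \<in> unseparated V (map (\<lambda>S. (S, cc_oracle E S)) Ss) \<longleftrightarrow> u \<in> V \<and> w \<in> V \<and> u \<noteq> w \<and>
     (\<forall>S\<in>set Ss. u \<in> S \<longrightarrow> w \<in> S \<longrightarrow> (u, w) \<in> (induced_adj E S)\<^sup>*)"
proof -
  have "{u, w} \<in> unseparated V (map (\<lambda>S. (S, cc_oracle E S)) Ss) \<longleftrightarrow> u \<in> V \<and> w \<in> V \<and> u \<noteq> w \<and>
     (\<forall>S\<in>set Ss. u \<in> S \<longrightarrow> w \<in> S \<longrightarrow> same_block (cc_oracle E S) u w)"
    unfolding unseparated_def using same_block_commute by (fastforce simp: doubleton_eq_iff)
  then show ?thesis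
    by (auto simp: same_block_cc_oracle)
qed

text \<open>Adjacent vertices share a component in every query containing both, so the error is
  one-sided.\<close>

lemma edges_subset_unseparated:
  assumes "simple_graph V E"
  shows "E \<subseteq> unseparated V (map (\<lambda>S. (S, cc_oracle E S)) Ss)"
proof
  fix e assume "e \<in> E"
  then have "card e = 2" "e \<subseteq> V"
    using assms by (auto simp: simple_graph_def)
  then obtain u w where "e = {u, w}" "u \<noteq> w"
    by (auto simp: card_2_iff)
  with \<open>e \<in> E\<close> \<open>e \<subseteq> V\<close> show "e \<in> unseparated V (map (\<lambda>S. (S, cc_oracle E S)) Ss)"
    by (auto simp: unseparated_cc_oracle_iff induced_adj_def)
qed

text \<open>Quantifying over all \<open>E \<subseteq> H\<close> makes this a property of
  \<open>c\<close> and \<open>H\<close> only, so the algorithm can search for \<open>c\<close>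
  without knowing the hidden edges.\<close>

definition decodes :: "('a \<Rightarrow> nat) \<Rightarrow> 'a set set \<Rightarrow> bool" where
  "decodes c H \<longleftrightarrow> (\<forall>E\<subseteq>H. \<forall>u w. {u, w} \<in> H \<longrightarrow>
     (u, w) \<in> (induced_adj E {x. c x \<in> {c u, c w}})\<^sup>* \<longrightarrow> {u, w} \<in> E)"

text \<open>A path from \<open>u\<close> to \<open>w\<close> inside the two color classes has to
  leave the set \<open>T\<close> of \<open>chordal_coloring\<close>, which only the edge
  \<open>{u, w}\<close> itself can do.\<close>

lemma chordal_decodes:
  assumes "chordal k V G"
  shows "\<exists>c. (\<forall>x. c x \<le> k) \<and> decodes c G"
proof -
  obtain c :: "'a \<Rightarrow> nat" where le: "\<And>x. c x \<le> k"
    and cut: "\<And>u w. {u, w} \<in> G \<Longrightarrow> \<exists>T. u \<in> T \<and> w \<notin> T \<and>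
      (\<forall>a b. {a, b} \<in> G \<longrightarrow> a \<in> T \<longrightarrow> b \<notin> T \<longrightarrow> c a \<in> {c u, c w} \<longrightarrow> c b \<in> {c u, c w} \<longrightarrow>
        {a, b} = {u, w})"
    using chordal_coloring[OF assms] by metis
  have "{u, w} \<in> E"
    if sub: "E \<subseteq> G" and uw: "{u, w} \<in> G"
      and reach: "(u, w) \<in> (induced_adj E {x. c x \<in> {c u, c w}})\<^sup>*" for E u w
  proof (rule ccontr)
    assume "{u, w} \<notin> E"
    obtain T where T: "u \<in> T" "w \<notin> T"
      "\<And>a b. {a, b} \<in> G \<Longrightarrow> a \<in> T \<Longrightarrow> b \<notin> T \<Longrightarrow> c a \<in> {c u, c w} \<Longrightarrow> c b \<in> {c u, c w} \<Longrightarrow>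
        {a, b} = {u, w}"
      using cut[OF uw] by blast
    have closed: "b \<in> T" if "a \<in> T" "(a, b) \<in> induced_adj E {x. c x \<in> {c u, c w}}" for a b
    proof (rule ccontr)
      assume "b \<notin> T"
      have ab: "{a, b} \<in> E" "c a \<in> {c u, c w}" "c b \<in> {c u, c w}"
        using that(2) by (simp_all add: induced_adj_def)
      have "{a, b} = {u, w}"
        by (rule T(3)) (use ab that(1) sub \<open>b \<notin> T\<close> in blast)+
      with ab(1) \<open>{u, w} \<notin> E\<close> show False by simp
    qed
    have "w \<in> T"
      using reach by (induction rule: rtrancl_induct) (use T(1) closed in blast)+
    with T(2) show False by blast
  qed
  then have "decodes c G"
    unfolding decodes_def by (intro allI impI)
  with le show ?thesis by blast
qed

text \<open>Transfers a coloring from the unknown \<open>G\<close> to the known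
  \<open>H\<close>.\<close>

lemma decodes_mono: "decodes c G \<Longrightarrow> H \<subseteq> G \<Longrightarrow> decodes c H"
  unfolding decodes_def by (meson order_trans subsetD)

text \<open>Ordered pairs of colors, including equal ones, make the number of queries exactly
  \<open>(k + 1)\<^sup>2\<close>.\<close>

definition class_unions :: "'a set \<Rightarrow> nat \<Rightarrow> ('a \<Rightarrow> nat) \<Rightarrow> 'a set list" where
  "class_unions V k c =
     map (\<lambda>(i, j). {x \<in> V. c x \<in> {i, j}}) (List.product [0..<k + 1] [0..<k + 1])"

text \<open>The choice of \<open>c\<close> from the first batch of answers is the only adaptive
  step. \<open>SOME\<close> is admissible since only queries are counted, not computation.\<close>

definition reconstruct :: "'a set \<Rightarrow> nat \<Rightarrow> 'a set list \<Rightarrow> 'a query_tree" where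
  "reconstruct V k Ss = ask_all Ss (\<lambda>R.
     let H = unseparated V R; c = (SOME c. (\<forall>x. c x \<le> k) \<and> decodes c H)
     in ask_all (class_unions V k c) (\<lambda>R'. Output (H \<inter> unseparated V R')))"

lemma length_run_reconstruct:
  "length (run_queries E (reconstruct V k Ss)) = length Ss + (k + 1)\<^sup>2"
  by (simp add: reconstruct_def Let_def run_queries_ask_all class_unions_def power2_eq_square)

lemma run_reconstruct_subset:
  "set Ss \<subseteq> Pow V \<Longrightarrow> set (run_queries E (reconstruct V k Ss)) \<subseteq> Pow V"
  by (auto simp: reconstruct_def Let_def run_queries_ask_all class_unions_def)

lemma run_output_reconstruct:
  assumes "simple_graph V E" "chordal k V G"
    and "unseparated V (map (\<lambda>S. (S, cc_oracle E S)) Ss) \<subseteq> G"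
  shows "run_output E (reconstruct V k Ss) = E"
proof -
  define H where "H = unseparated V (map (\<lambda>S. (S, cc_oracle E S)) Ss)"
  define c where "c = (SOME c. (\<forall>x. c x \<le> k) \<and> decodes c H)"
  let ?H' = "unseparated V (map (\<lambda>S. (S, cc_oracle E S)) (class_unions V k c))"
  \<comment> \<open>The coloring of \<open>G\<close> also decodes \<open>H\<close>, so the choice
    succeeds, though it may pick another coloring.\<close>
  have "\<exists>c. (\<forall>x. c x \<le> k) \<and> decodes c H"
    using chordal_decodes[OF assms(2)] assms(3) decodes_mono unfolding H_def by blast
  then have "(\<forall>x. c x \<le> k) \<and> decodes c H"
    unfolding c_def by (rule someI_ex)
  then have c: "\<And>x. c x \<le> k" "decodes c H"
    by auto
  have "E \<subseteq> H \<inter> ?H'"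
    using edges_subset_unseparated[OF assms(1)] unfolding H_def by blast
  moreover have "e \<in> E" if e: "e \<in> H" "e \<in> ?H'" for e
  proof -
    obtain u w where uw: "e = {u, w}"
      using e(1) by (auto simp: H_def unseparated_def)
    let ?S = "{x \<in> V. c x \<in> {c u, c w}}"
    have "?S \<in> set (class_unions V k c)"
      using c(1)[of u] c(1)[of w] by (force simp: class_unions_def)
    moreover have "u \<in> ?S" "w \<in> ?S"
      and "\<forall>S\<in>set (class_unions V k c). u \<in> S \<longrightarrow> w \<in> S \<longrightarrow> (u, w) \<in> (induced_adj E S)\<^sup>*"
      using e(2) unfolding uw unseparated_cc_oracle_iff by simp_all
    ultimately have "(u, w) \<in> (induced_adj E ?S)\<^sup>*"
      by metis
    \<comment> \<open>Queries stay inside \<open>V\<close>, whereas \<open>decodes\<close> speaks of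
      entire color classes.\<close>
    moreover have "induced_adj E ?S \<subseteq> induced_adj E {x. c x \<in> {c u, c w}}"
      by (intro induced_adj_mono) auto
    ultimately have "(u, w) \<in> (induced_adj E {x. c x \<in> {c u, c w}})\<^sup>*"
      by (meson rtrancl_mono subsetD)
    then show "e \<in> E"
      using c(2) e(1) \<open>E \<subseteq> H \<inter> ?H'\<close> unfolding uw decodes_def by (metis le_inf_iff)
  qed
  moreover have "run_output E (reconstruct V k Ss) = H \<inter> ?H'"
    by (simp add: reconstruct_def Let_def run_output_ask_all H_def c_def)
  ultimately show ?thesis by blast
qed

section \<open>Random queries\<close>

definition random_subset :: "'a set \<Rightarrow> real \<Rightarrow> 'a set pmf" where
  "random_subset V p = map_pmf (\<lambda>b. {x \<in> V. b x}) (Pi_pmf V False (\<lambda>_. bernoulli_pmf p))"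

lemma set_pmf_random_subset: "set_pmf (random_subset V p) \<subseteq> Pow V"
  by (auto simp: random_subset_def)

text \<open>A product event: the coins of \<open>A\<close> and \<open>X\<close> are prescribed, all
  others contribute a factor 1.\<close>

lemma prob_random_subset:
  assumes "finite V" "A \<subseteq> V" "X \<subseteq> V" "A \<inter> X = {}" "0 \<le> p" "p \<le> 1"
  shows "measure_pmf.prob (random_subset V p) {S. A \<subseteq> S \<and> S \<inter> X = {}} =
    p ^ card A * (1 - p) ^ card X"
proof -
  let ?P = "Pi_pmf V False (\<lambda>_. bernoulli_pmf p)"
  let ?B = "\<lambda>x. if x \<in> A then {True} else if x \<in> X then {False} else UNIV"
  have "measure_pmf.prob (random_subset V p) {S. A \<subseteq> S \<and> S \<inter> X = {}} =
      measure_pmf.prob ?P (Pi V ?B)"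
  proof -
    have mem_B: "b x \<in> ?B x \<longleftrightarrow> (x \<in> A \<longrightarrow> b x) \<and> (x \<in> X \<longrightarrow> \<not> b x)" for b x
      using assms(4) by auto
    have iff: "b \<in> Pi V ?B \<longleftrightarrow> A \<subseteq> {x \<in> V. b x} \<and> {x \<in> V. b x} \<inter> X = {}" for b
      unfolding Pi_iff mem_B using assms(2,3) by auto
    have "(\<lambda>b. {x \<in> V. b x}) -` {S. A \<subseteq> S \<and> S \<inter> X = {}} = Pi V ?B"
      by (intro set_eqI) (simp only: iff vimage_eq mem_Collect_eq)
    then show ?thesis
      by (simp only: random_subset_def measure_map_pmf)
  qed
  also have "\<dots> = (\<Prod>x\<in>V. measure_pmf.prob (bernoulli_pmf p) (?B x))"
    using assms by (intro measure_Pi_pmf_Pi)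
  also have "\<dots> = (\<Prod>x\<in>A \<union> X. measure_pmf.prob (bernoulli_pmf p) (?B x))"
    using assms by (intro prod.mono_neutral_right) auto
  also have "\<dots> = (\<Prod>x\<in>A. measure_pmf.prob (bernoulli_pmf p) (?B x)) *
      (\<Prod>x\<in>X. measure_pmf.prob (bernoulli_pmf p) (?B x))"
    using assms by (intro prod.union_disjoint) (auto intro: finite_subset)
  also have "(\<Prod>x\<in>A. measure_pmf.prob (bernoulli_pmf p) (?B x)) = (\<Prod>x\<in>A. p)"
    using assms by (intro prod.cong) (auto simp: measure_pmf_single)
  also have "(\<Prod>x\<in>X. measure_pmf.prob (bernoulli_pmf p) (?B x)) = (\<Prod>x\<in>X. 1 - p)"
    using assms by (intro prod.cong) (auto simp: measure_pmf_single)
  finally show ?thesis by simp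
qed

section \<open>Numerical estimates\<close>

text \<open>The second factor is smallest for \<open>m = k\<close>, where it equals
  \<open>1 / (1 + 1 / k) ^ k\<close>, at least \<open>1 / exp 1\<close> and so at least
  \<open>1 / 3\<close>.\<close>

lemma separation_prob_bound:
  fixes k :: nat
  assumes "0 < k" and "m \<le> k"
  shows "1 / (3 * (real k + 1)\<^sup>2) \<le> (1 / (real k + 1)) ^ 2 * (1 - 1 / (real k + 1)) ^ m"
proof -
  have "(1 + 1 / real k) ^ k \<le> exp (1 / real k) ^ k"
    by (intro power_mono exp_ge_add_one_self) auto
  also have "\<dots> = exp 1"
    using assms by (simp flip: exp_of_nat_mult)
  also have "\<dots> \<le> 3" by (rule exp_le)
  finally have "(1 + 1 / real k) ^ k \<le> 3" .
  then have "1 / 3 \<le> 1 / (1 + 1 / real k) ^ k"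
    by (intro divide_left_mono) (auto intro!: zero_less_power add_pos_nonneg)
  also have "\<dots> = (1 - 1 / (real k + 1)) ^ k"
    using assms by (simp add: power_one_over[symmetric] field_simps)
  also have "\<dots> \<le> (1 - 1 / (real k + 1)) ^ m"
    using assms by (intro power_decreasing) auto
  finally have "(1 / (real k + 1)) ^ 2 * (1 / 3) \<le>
      (1 / (real k + 1)) ^ 2 * (1 - 1 / (real k + 1)) ^ m"
    by (intro mult_left_mono) auto
  then show ?thesis
    by (simp add: power_divide mult.commute)
qed

text \<open>The constant is \<open>9 = 3 * 3\<close>: one factor 3 offsets the separation
  probability \<open>1 / (3 * (k + 1)\<^sup>2)\<close>, the other gives failure probability
  \<open>1 / n ^ 3\<close> per pair.\<close>

definition rounds :: "nat \<Rightarrow> nat \<Rightarrow> nat" where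
  "rounds k n = nat \<lceil>9 * (real k + 1)\<^sup>2 * ln (real n)\<rceil>"

lemma rounds_failure_prob:
  assumes "1 \<le> n" "1 / (3 * (real k + 1)\<^sup>2) \<le> q" "q \<le> 1"
  shows "(1 - q) ^ rounds k n \<le> 1 / real n ^ 3"
proof -
  have ge: "9 * (real k + 1)\<^sup>2 * ln (real n) \<le> real (rounds k n)"
    unfolding rounds_def by (simp add: real_nat_ceiling_ge)
  have nonneg: "0 \<le> q" "0 \<le> 9 * (real k + 1)\<^sup>2 * ln (real n)"
    using assms by (auto intro: order_trans[rotated])
  have "3 * ln (real n) = 1 / (3 * (real k + 1)\<^sup>2) * (9 * (real k + 1)\<^sup>2 * ln (real n))"
    by (simp add: add_pos_nonneg field_simps)
  also have "\<dots> \<le> q * real (rounds k n)"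
    by (rule mult_mono[OF assms(2) ge nonneg])
  finally have exponent: "3 * ln (real n) \<le> q * real (rounds k n)" .
  have "(1 - q) ^ rounds k n \<le> exp (- q) ^ rounds k n"
    using assms exp_ge_add_one_self[of "- q"] by (intro power_mono) auto
  also have "\<dots> = exp (- (q * real (rounds k n)))"
    by (simp flip: exp_of_nat_mult add: mult.commute)
  also have "\<dots> \<le> exp (- (3 * ln (real n)))"
    using exponent by simp
  also have "\<dots> = 1 / real n ^ 3"
    using assms exp_of_nat_mult[of 3 "ln (real n)"] by (simp add: exp_minus inverse_eq_divide)
  finally show ?thesis .
qed

text \<open>Here \<open>46 = 9 * 4 + 5 * 2\<close>:
  \<open>(k + 1)\<^sup>2 \<le> 4 * k\<^sup>2\<close> is used twice, rounding up costs at most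
  \<open>k\<^sup>2\<close>, and \<open>1 \<le> 2 * ln n\<close> absorbs the resulting
  \<open>5 * k\<^sup>2\<close>.\<close>

lemma query_count_bound:
  assumes "1 \<le> k" "2 \<le> n"
  shows "real (rounds k n + (k + 1)\<^sup>2) \<le> 46 * real k ^ 2 * ln (real n)"
proof -
  have "exp (1 / 2 :: real) ^ 2 \<le> 2 ^ 2"
    using exp_le by (simp flip: exp_of_nat_mult)
  then have "exp (1 / 2 :: real) \<le> 2"
    by (rule power2_le_imp_le) simp
  then have "1 / 2 \<le> ln (2 :: real)"
    by (subst ln_ge_iff) auto
  also have "\<dots> \<le> ln (real n)"
    using assms by simp
  finally have L: "1 \<le> 2 * ln (real n)" by simp
  have k2: "(real k + 1)\<^sup>2 \<le> 4 * (real k)\<^sup>2"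
    using power_mono[of "real k + 1" "2 * real k" 2] assms by (simp add: power_mult_distrib)
  have "real (rounds k n) \<le> 9 * (real k + 1)\<^sup>2 * ln (real n) + 1"
    unfolding rounds_def using assms by simp
  also have "\<dots> \<le> 9 * (4 * (real k)\<^sup>2) * ln (real n) + (real k)\<^sup>2"
    using k2 L assms by (intro add_mono mult_right_mono mult_left_mono) auto
  finally have "real (rounds k n) + (real k + 1)\<^sup>2 \<le>
      36 * (real k)\<^sup>2 * ln (real n) + 5 * (real k)\<^sup>2"
    using k2 by simp
  also have "\<dots> \<le> 36 * (real k)\<^sup>2 * ln (real n) + 5 * ((real k)\<^sup>2 * (2 * ln (real n)))"
    using mult_left_mono[OF L zero_le_power2, of "real k"] by linarith
  finally show ?thesis by (simp add: algebra_simps)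
qed

section \<open>Failure probability\<close>

text \<open>A union bound over at most \<open>n\<^sup>2\<close> pairs, each failing with probability
  at most \<open>1 / n ^ 3\<close>.\<close>

lemma prob_some_pair_unseparated:
  assumes "1 \<le> k" "simple_graph V E" "chordal k V G" "E \<subseteq> G"
  shows "measure_pmf.prob
      (Pi_pmf {..<rounds k (card V)} {} (\<lambda>_. random_subset V (1 / (real k + 1))))
      {f. \<not> unseparated V (map (\<lambda>S. (S, cc_oracle E S)) (map f [0..<rounds k (card V)])) \<subseteq> G}
    \<le> 1 / real (card V)"
proof -
  let ?N = "rounds k (card V)" and ?p = "1 / (real k + 1)"
  let ?M = "Pi_pmf {..<?N} {} (\<lambda>_. random_subset V ?p)"
  let ?H = "\<lambda>f. unseparated V (map (\<lambda>S. (S, cc_oracle E S)) (map f [0..<?N]))"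
  have "finite V"
    using assms by (simp add: simple_graph_def)
  define D where "D = {(u, w). u \<in> V \<and> w \<in> V \<and> u \<noteq> w \<and> {u, w} \<notin> G}"
  have D: "D \<subseteq> V \<times> V" "finite D"
    using \<open>finite V\<close> by (auto simp: D_def intro: finite_subset[of _ "V \<times> V"])
  have one: "measure_pmf.prob ?M {f. {u, w} \<in> ?H f} \<le> 1 / real (card V) ^ 3"
    if "(u, w) \<in> D" for u w
  proof -
    have uw: "u \<in> V" "w \<in> V" "u \<noteq> w" "{u, w} \<notin> G"
      using that by (auto simp: D_def)
    obtain T X where X: "X \<subseteq> V" "card X \<le> k" "u \<in> T" "u \<notin> X" "w \<notin> T" "w \<notin> X"
      and closed: "\<And>a b. {a, b} \<in> G \<Longrightarrow> a \<in> T \<Longrightarrow> b \<in> T \<union> X"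
      using chordal_separator[OF assms(3) uw] by blast
    \<comment> \<open>Queries that certify non-adjacency: both vertices are present and their
      separator is absent.\<close>
    define Good where "Good = {S. {u, w} \<subseteq> S \<and> S \<inter> X = {}}"
    define q where "q = measure_pmf.prob (random_subset V ?p) Good"
    have q_eq: "q = ?p ^ card {u, w} * (1 - ?p) ^ card X"
      unfolding q_def Good_def using \<open>finite V\<close> uw X by (intro prob_random_subset) auto
    have q: "1 / (3 * (real k + 1)\<^sup>2) \<le> q"
      \<comment> \<open>The composed rule is just \<open>card {u, w} = 2\<close>.\<close>
      unfolding q_eq card_2_iff[THEN iffD2, OF exI, OF exI, OF conjI, OF refl uw(3)]
      by (rule separation_prob_bound) (use assms X in auto)
    \<comment> \<open>A walk in \<open>S\<close> that starts at \<open>u\<close> stays in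
      \<open>T\<close>, as \<open>E \<subseteq> G\<close> and it could only leave through
      \<open>X\<close>.\<close>
    have separated: "(u, w) \<notin> (induced_adj E S)\<^sup>*" if "S \<in> Good" for S
    proof
      assume "(u, w) \<in> (induced_adj E S)\<^sup>*"
      then have "w \<in> T"
      proof (induction rule: rtrancl_induct)
        case (step a b)
        then show ?case
          using closed[of a b] assms(4) \<open>S \<in> Good\<close> by (auto simp: induced_adj_def Good_def)
      qed (use X in simp)
      with X show False by blast
    qed
    \<comment> \<open>A surviving pair means that none of the independent queries was good.\<close>
    have "{f. {u, w} \<in> ?H f} \<subseteq> Pi {..<?N} (\<lambda>_. - Good)"
    proof (intro subsetI Pi_I ComplI)
      fix f n
      assume "f \<in> {f. {u, w} \<in> ?H f}" "n \<in> {..<?N}" "f n \<in> Good"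
      then have "(u, w) \<in> (induced_adj E (f n))\<^sup>*"
        unfolding mem_Collect_eq unseparated_cc_oracle_iff by (simp add: Good_def)
      with separated \<open>f n \<in> Good\<close> show False by blast
    qed
    then have "measure_pmf.prob ?M {f. {u, w} \<in> ?H f} \<le>
        measure_pmf.prob ?M (Pi {..<?N} (\<lambda>_. - Good))"
      by (rule measure_pmf.finite_measure_mono) simp
    also have "\<dots> = (\<Prod>n<?N. measure_pmf.prob (random_subset V ?p) (- Good))"
      by (intro measure_Pi_pmf_Pi) auto
    also have "\<dots> = (1 - q) ^ ?N"
      using measure_pmf.prob_compl[of Good "random_subset V ?p"]
      by (simp add: q_def Compl_eq_Diff_UNIV)
    also have "\<dots> \<le> 1 / real (card V) ^ 3"
      using q uw \<open>finite V\<close>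
      by (intro rounds_failure_prob) (auto simp: q_def card_gt_0_iff Suc_le_eq)
    finally show ?thesis .
  qed
  have "{f. \<not> ?H f \<subseteq> G} \<subseteq> (\<Union>(u, w)\<in>D. {f. {u, w} \<in> ?H f})"
  proof
    fix f assume "f \<in> {f. \<not> ?H f \<subseteq> G}"
    then obtain e where e: "e \<in> ?H f" "e \<notin> G" by auto
    moreover from e(1) obtain u w where "e = {u, w}" "u \<in> V" "w \<in> V" "u \<noteq> w"
      unfolding unseparated_def by blast
    ultimately show "f \<in> (\<Union>(u, w)\<in>D. {f. {u, w} \<in> ?H f})"
      by (auto simp: D_def)
  qed
  then have "measure_pmf.prob ?M {f. \<not> ?H f \<subseteq> G} \<le>
      measure_pmf.prob ?M (\<Union>(u, w)\<in>D. {f. {u, w} \<in> ?H f})"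
    by (rule measure_pmf.finite_measure_mono) simp
  also have "\<dots> \<le> (\<Sum>x\<in>D. measure_pmf.prob ?M (case x of (u, w) \<Rightarrow> {f. {u, w} \<in> ?H f}))"
    using D(2) by (intro measure_pmf.finite_measure_subadditive_finite) auto
  also have "\<dots> \<le> (\<Sum>x\<in>D. 1 / real (card V) ^ 3)"
    using one by (intro sum_mono) (auto split: prod.split)
  also have "\<dots> = real (card D) / real (card V) ^ 3"
    by simp
  also have "\<dots> \<le> real (card V * card V) / real (card V) ^ 3"
    using card_mono[OF _ D(1)] \<open>finite V\<close>
    by (intro divide_right_mono of_nat_mono) (auto simp: card_cartesian_product)
  \<comment> \<open>For empty \<open>V\<close> both sides are 0, since division by 0 yields
    0.\<close>
  also have "\<dots> \<le> 1 / real (card V)"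
    by (simp add: power3_eq_cube)
  finally show ?thesis .
qed

section \<open>The randomized algorithm\<close>

text \<open>For \<open>k = 0\<close> the query budget vanishes, and there are no edges to
  find.\<close>

definition random_reconstruct :: "'a set \<Rightarrow> nat \<Rightarrow> 'a query_tree pmf" where
  "random_reconstruct V k = (if k = 0 then return_pmf (Output {}) else
     let N = rounds k (card V)
     in map_pmf (\<lambda>f. reconstruct V k (map f [0..<N]))
          (Pi_pmf {..<N} {} (\<lambda>_. random_subset V (1 / (real k + 1)))))"

text \<open>The bound holds for every outcome of the coins, as the number of queries depends only on
  \<open>k\<close> and \<open>card V\<close>.\<close>

lemma random_reconstruct_queries:
  assumes "simple_graph V E" "treewidth V E = k" "t \<in> set_pmf (random_reconstruct V k)"
  shows "set (run_queries E t) \<subseteq> Pow V \<and>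
    real (length (run_queries E t)) \<le> 46 * real k ^ 2 * ln (real (card V))"
proof (cases "k = 0")
  case True
  then show ?thesis
    using assms(3) by (simp add: random_reconstruct_def)
next
  case False
  let ?N = "rounds k (card V)"
  obtain f where t: "t = reconstruct V k (map f [0..<?N])"
    and f: "f \<in> set_pmf (Pi_pmf {..<?N} {} (\<lambda>_. random_subset V (1 / (real k + 1))))"
    using assms(3) False by (auto simp: random_reconstruct_def Let_def)
  have "f n \<in> set_pmf (random_subset V (1 / (real k + 1)))" if "n < ?N" for n
    using f that by (auto simp: set_Pi_pmf PiE_dflt_def)
  then have "set (map f [0..<?N]) \<subseteq> Pow V"
    using set_pmf_random_subset by fastforce
  moreover have "2 \<le> card V"
    using treewidth_le[OF assms(1)] assms(2) False by simp
  ultimately show ?thesis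
    using run_reconstruct_subset[of "map f [0..<?N]" V E k] query_count_bound[of k "card V"] False
    by (simp add: t length_run_reconstruct)
qed

text \<open>For \<open>k > 0\<close> the output can be wrong only if some pair outside
  \<open>G\<close> is never separated by the random queries.\<close>

lemma random_reconstruct_correct:
  assumes "simple_graph V E" "treewidth V E = k"
  shows "measure_pmf.prob (random_reconstruct V k) {t. run_output E t = E} \<ge> 1 - 1 / real (card V)"
proof -
  obtain G where G: "chordal k V G" "E \<subseteq> G"
    using treewidth_chordal[OF assms(1)] assms(2) by blast
  show ?thesis
  proof (cases "k = 0")
    case True
    then have "E = {}"
      using G chordal_0 by blast
    then show ?thesis
      using True by (simp add: random_reconstruct_def measure_return_pmf)
  next
    case False
    let ?N = "rounds k (card V)"
    let ?M = "Pi_pmf {..<?N} {} (\<lambda>_. random_subset V (1 / (real k + 1)))"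
    let ?bad = "{f. \<not> unseparated V (map (\<lambda>S. (S, cc_oracle E S)) (map f [0..<?N])) \<subseteq> G}"
    have "1 - 1 / real (card V) \<le> 1 - measure_pmf.prob ?M ?bad"
      using prob_some_pair_unseparated[OF _ assms(1) G] False by simp
    also have "\<dots> = measure_pmf.prob ?M (- ?bad)"
      using measure_pmf.prob_compl[of ?bad ?M] by (simp add: Compl_eq_Diff_UNIV)
    also have "\<dots> \<le> measure_pmf.prob ?M {f. run_output E (reconstruct V k (map f [0..<?N])) = E}"
      using run_output_reconstruct[OF assms(1) G(1)]
      by (intro measure_pmf.finite_measure_mono) auto
    also have "\<dots> = measure_pmf.prob (random_reconstruct V k) {t. run_output E t = E}"
      using False by (simp add: random_reconstruct_def Let_def measure_map_pmf vimage_def)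
    finally show ?thesis .
  qed
qed

theorem theorem5:
  "\<exists>(A :: 'a set \<Rightarrow> nat \<Rightarrow> 'a query_tree pmf) (C :: real) (\<delta> :: nat \<Rightarrow> real).
     \<delta> \<longlonglongrightarrow> 0 \<and>
     (\<forall>V E k. simple_graph V E \<and> treewidth V E = k \<longrightarrow>
        (\<forall>t\<in>set_pmf (A V k).
           set (run_queries E t) \<subseteq> Pow V \<and>
           real (length (run_queries E t)) \<le> C * real k ^ 2 * ln (real (card V))) \<and>
        measure_pmf.prob (A V k) {t. run_output E t = E} \<ge> 1 - \<delta> (card V))"
proof (rule exI[of _ random_reconstruct], rule exI[of _ 46], rule exI[of _ "\<lambda>n. 1 / real n"],
    intro conjI allI impI ballI)
  show "(\<lambda>n. 1 / real n) \<longlonglongrightarrow> 0"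
    by (rule lim_1_over_n)
next
  fix V :: "'a set" and E k t
  assume *: "simple_graph V E \<and> treewidth V E = k" and t: "t \<in> set_pmf (random_reconstruct V k)"
  from random_reconstruct_queries[OF conjunct1[OF *] conjunct2[OF *] t]
  show "set (run_queries E t) \<subseteq> Pow V"
    and "real (length (run_queries E t)) \<le> 46 * real k ^ 2 * ln (real (card V))"
    by (rule conjunct1, rule conjunct2)
next
  fix V :: "'a set" and E k
  assume *: "simple_graph V E \<and> treewidth V E = k"
  show "1 - 1 / real (card V) \<le>
      measure_pmf.prob (random_reconstruct V k) {t. run_output E t = E}"
    by (rule random_reconstruct_correct[OF conjunct1[OF *] conjunct2[OF *]])
qed

end
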